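(* Let $\mathfrak{A}(\tau)=\{A_1(\tau),\ldots,A_M(\tau)\}$ be a family of real $N\times N$ matrices depending on a real parameter $\tau$, which is quasi-controllable and continuous at $\tau=0$. Suppose that the difference equation $x(n+1)=A(n)x(n)$ is not Lyapunov absolutely stable with respect to the family $\mathfrak{A}(0)$. Then for all sufficiently small $\tau$ the equation $x(n+1)=A(n)x(n)$ is also not Lyapunov absolutely stable with respect to the family $\mathfrak{A}(\tau)$; in fact, for all sufficiently small $\tau$ it is absolutely exponentially unstable in the family $\mathfrak{A}(\tau)$.
   Context: Let $\|\cdot\|$ be a fixed norm on $\mathbb{R}^N$. A finite family $\mathfrak{A}$ of real $N\times N$ matrices is called quasi-controllable if no nonzero proper subspace of $\mathbb{R}^N$ is invariant for all matrices from $\mathfrak{A}$. Continuity of $\mathfrak{A}(\tau)$ at $\tau=0$ means that each matrix function $A_i(\tau)$ is continuous at $\tau=0$. The equation $x(n+1)=A(n)x(n)$ is called Lyapunov absolutely stable with respect to $\mathfrak{A}$ if there exists $\mu<\infty$ such that for each sequence $A(n)\in\mathfrak{A}$, $n=0,1,2,\ldots$, any solution $x(\cdot)$ of the corresponding equation satisfies $\sup_{n\ge0}\|x(n)\|\le\mu\|x(0)\|$. The equation is called absolutely exponentially unstable (with exponent $\lambda>1$) in the family $\mathfrak{A}$ if for some $\kappa>0$ and for each vector $x\in\mathbb{R}^N$, $x\ne0$, there exists a sequence $A(n)\in\mathfrak{A}$ such that the solution $x(n)$ of the corresponding equation with $x(0)=x$ satisfies $\|x(n)\|\ge\kappa\lambda^n\|x(0)\|$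 for $n=0,1,2,\ldots$; it is called absolutely exponentially unstable if this holds with some exponent $\lambda>1$. *)

theory Defs
  imports "HOL-Analysis.Analysis"
begin

definition is_norm :: "(real ^ 'n \<Rightarrow> real) \<Rightarrow> bool" where
  "is_norm nrm \<longleftrightarrow>
     (\<forall>x. 0 \<le> nrm x) \<and>
     (\<forall>x. nrm x = 0 \<longleftrightarrow> x = 0) \<and>
     (\<forall>c x. nrm (c *\<^sub>R x) = \<bar>c\<bar> * nrm x) \<and>
     (\<forall>x y. nrm (x + y) \<le> nrm x + nrm y)"

definition quasi_controllable :: "(real ^ 'n ^ 'n) set \<Rightarrow> bool" where
  "quasi_controllable F \<longleftrightarrow>
     \<not> (\<exists>V. subspace V \<and> V \<noteq> {0} \<and> V \<noteq> UNIV \<and> (\<forall>A\<in>F. \<forall>v\<in>V. A *v v \<in> V))"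

definition solution :: "(nat \<Rightarrow> real ^ 'n ^ 'n) \<Rightarrow> (nat \<Rightarrow> real ^ 'n) \<Rightarrow> bool" where
  "solution A x \<longleftrightarrow> (\<forall>n. x (Suc n) = A n *v x n)"

text \<open>The supremum is taken in the extended reals: the real-valued \<open>Sup\<close> of an unbounded set
  is unspecified and would not express unboundedness of a solution.\<close>

definition lyapunov_abs_stable ::
    "(real ^ 'n \<Rightarrow> real) \<Rightarrow> (real ^ 'n ^ 'n) set \<Rightarrow> bool" where
  "lyapunov_abs_stable nrm F \<longleftrightarrow>
     (\<exists>\<mu>::real. \<forall>A. (\<forall>n. A n \<in> F) \<longrightarrow>
        (\<forall>x. solution A x \<longrightarrow> (SUP n. ereal (nrm (x n))) \<le> ereal (\<mu> * nrm (x 0))))"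

definition abs_exp_unstable_with ::
    "(real ^ 'n \<Rightarrow> real) \<Rightarrow> real \<Rightarrow> (real ^ 'n ^ 'n) set \<Rightarrow> bool" where
  "abs_exp_unstable_with nrm lam F \<longleftrightarrow>
     lam > 1 \<and>
     (\<exists>\<kappa>>0. \<forall>v. v \<noteq> 0 \<longrightarrow>
        (\<exists>A x. (\<forall>n. A n \<in> F) \<and> solution A x \<and> x 0 = v \<and>
               (\<forall>n. nrm (x n) \<ge> \<kappa> * lam ^ n * nrm (x 0))))"

definition abs_exp_unstable ::
    "(real ^ 'n \<Rightarrow> real) \<Rightarrow> (real ^ 'n ^ 'n) set \<Rightarrow> bool" where
  "abs_exp_unstable nrm F \<longleftrightarrow> (\<exists>lam. abs_exp_unstable_with nrm lam F)"

end

theory Submission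
  imports Defs
begin

text \<open>The vectors whose orbit under all products of matrices from \<open>\<AA>(0)\<close> is bounded form an
  invariant subspace. It is not the whole space, since otherwise the products would be uniformly
  bounded and the equation stable; by quasi-controllability it is trivial. So every unit vector is
  expanded by a factor greater than 2 by some product, and by continuity and compactness of the
  unit sphere, for small \<open>\<tau>\<close> finitely many words in the matrices of \<open>\<AA>(\<tau>)\<close> suffice to at least double
  every vector. Concatenating such words greedily gives exponentially growing solutions.

  The product along a word \<open>w\<close> is applied to \<open>x\<close> as \<open>fold (*v) w x\<close>, the head of \<open>w\<close> acting first.\<close>

section \<open>Equivalence of norms, and matrix products along words\<close>

lemma is_norm_equiv_norm:
  fixes nrm :: "real ^ 'n \<Rightarrow> real"
  assumes "is_norm nrm"
  obtains c C where "0 < c" "0 < C" "\<And>x. c * norm x \<le> nrm x" "\<And>x. nrm x \<le> C * norm x"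
proof -
  have nonneg: "0 \<le> nrm x" and zero: "nrm x = 0 \<longleftrightarrow> x = 0"
    and scale: "nrm (a *\<^sub>R x) = \<bar>a\<bar> * nrm x" and triangle: "nrm (x + y) \<le> nrm x + nrm y"
    for x y a
    using assms by (auto simp: is_norm_def)
  \<comment> \<open>Convexity yields continuity in finite dimension. The extrema of
    \<open>nrm\<close> on the compact Euclidean unit sphere then serve as the two constants, by
    homogeneity.\<close>
  have "convex_on UNIV nrm"
  proof (rule convex_onI)
    fix t :: real and x y assume "0 < t" "t < 1"
    then show "nrm ((1 - t) *\<^sub>R x + t *\<^sub>R y) \<le> (1 - t) * nrm x + t * nrm y"
      using triangle[of "(1 - t) *\<^sub>R x" "t *\<^sub>R y"] by (simp add: scale)
  qed auto
  then have cont: "continuous_on (sphere 0 1) nrm"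
    by (meson convex_on_continuous open_UNIV continuous_on_subset subset_UNIV)
  have ne: "sphere (0 :: real ^ 'n) 1 \<noteq> {}"
    by simp
  obtain u where u: "u \<in> sphere 0 1" "\<And>x. x \<in> sphere 0 1 \<Longrightarrow> nrm u \<le> nrm x"
    using continuous_attains_inf[OF compact_sphere ne cont] by blast
  obtain v where v: "v \<in> sphere 0 1" "\<And>x. x \<in> sphere 0 1 \<Longrightarrow> nrm x \<le> nrm v"
    using continuous_attains_sup[OF compact_sphere ne cont] by blast
  have pos: "0 < nrm w" if "w \<in> sphere 0 1" for w
    using that nonneg[of w] zero[of w] by (cases "nrm w = 0") auto
  have unit: "nrm x = norm x * nrm (x /\<^sub>R norm x)" "x /\<^sub>R norm x \<in> sphere 0 1" if "x \<noteq> 0" for x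
    using that by (simp_all add: scale)
  show thesis
  proof
    show "0 < nrm u" "0 < nrm v"
      using pos u(1) v(1) by auto
    fix x
    show "nrm u * norm x \<le> nrm x"
    proof (cases "x = 0")
      case False
      then have "norm x * nrm u \<le> norm x * nrm (x /\<^sub>R norm x)"
        using u(2)[OF unit(2)] by (intro mult_left_mono) auto
      then show ?thesis
        using unit(1)[OF False] by (simp add: mult.commute)
    qed (simp add: nonneg)
    show "nrm x \<le> nrm v * norm x"
    proof (cases "x = 0")
      case False
      then have "norm x * nrm (x /\<^sub>R norm x) \<le> norm x * nrm v"
        using v(2)[OF unit(2)] by (intro mult_left_mono) auto
      then show ?thesis
        using unit(1)[OF False] by (simp add: mult.commute)
    qed (use zero[of 0] in simp)
  qed
qed

lemma bounded_bilinear_matrix_vector_mult: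
  "bounded_bilinear ((*v) :: real ^ 'n ^ 'm \<Rightarrow> real ^ 'n \<Rightarrow> real ^ 'm)"
  unfolding bilinear_conv_bounded_bilinear[symmetric] bilinear_def
  by (auto intro!: linearI simp: matrix_vector_mult_add_rdistrib matrix_vector_right_distrib
      matrix_vector_mult_scaleR scaleR_matrix_vector_assoc)

lemma linear_fold_matrix_vector_mult: "linear (fold (*v) (w :: (real ^ 'n ^ 'n) list))"
proof (induction w)
  case Nil
  show ?case by (simp add: linear_iff)
next
  case (Cons A w)
  have "linear (fold (*v) w \<circ> (*v) A)"
    by (intro linear_compose Cons.IH matrix_vector_mul_linear)
  then show ?case by (simp add: o_def)
qed

lemma norm_fold_matrix_vector_mult_le:
  fixes w :: "(real ^ 'n ^ 'n) list"
  assumes "0 \<le> C" and "\<And>A x. A \<in> set w \<Longrightarrow> norm (A *v x) \<le> C * norm x"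
  shows "norm (fold (*v) w x) \<le> C ^ length w * norm x"
  using assms(2)
proof (induction w arbitrary: x)
  case (Cons A w)
  have "norm (fold (*v) w (A *v x)) \<le> C ^ length w * norm (A *v x)"
    by (rule Cons.IH) (simp add: Cons.prems)
  also have "\<dots> \<le> C ^ length w * (C * norm x)"
    using Cons.prems assms(1) by (intro mult_left_mono) auto
  finally show ?case by (simp add: mult_ac)
qed simp

text \<open>The vector varies along with the matrices: this gives joint continuity in parameter and
  vector, and lets the induction absorb the first matrix into \<open>h\<close>.\<close>

lemma tendsto_fold_matrix_vector_mult:
  fixes B :: "'i \<Rightarrow> 'a \<Rightarrow> real ^ 'n ^ 'n"
  assumes "\<And>i. i \<in> set w \<Longrightarrow> (B i \<longlongrightarrow> b i) F" and "(h \<longlongrightarrow> l) F"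
  shows "((\<lambda>p. fold (*v) (map (\<lambda>i. B i p) w) (h p)) \<longlongrightarrow> fold (*v) (map b w) l) F"
  using assms
proof (induction w arbitrary: h l)
  case (Cons i w)
  have "((\<lambda>p. B i p *v h p) \<longlongrightarrow> b i *v l) F"
    by (intro bounded_bilinear.tendsto[OF bounded_bilinear_matrix_vector_mult] Cons.prems) simp
  with Cons show ?case by simp
qed simp

section \<open>Bounded orbits, stability and quasi-controllability\<close>

lemma solution_eq_fold:
  assumes "solution A x"
  shows "x n = fold (*v) (map A [0..<n]) (x 0)"
  using assms by (induction n) (auto simp: solution_def)

text \<open>Uniform boundedness in finite dimension: by linearity, bounds on the orbits of the
  finitely many basis vectors bound all products at once.\<close>

lemma lyapunov_abs_stable_if_bounded_orbits:
  fixes F :: "(real ^ 'n ^ 'n) set"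
  assumes "is_norm nrm" and "\<And>x. bounded ((\<lambda>w. fold (*v) w x) ` lists F)"
  shows "lyapunov_abs_stable nrm F"
proof -
  obtain c C where c: "0 < c" "0 < C" "\<And>x. c * norm x \<le> nrm x" "\<And>x. nrm x \<le> C * norm x"
    using is_norm_equiv_norm[OF assms(1)] by metis
  obtain B where B: "\<And>x w. w \<in> lists F \<Longrightarrow> norm (fold (*v) w x) \<le> B x"
    using assms(2) unfolding bounded_iff by (metis imageI)
  define K where "K = (\<Sum>b\<in>(Basis :: (real ^ 'n) set). B b)"
  have B0: "0 \<le> B x" for x
    using order_trans[OF norm_ge_zero B[of "[]" x]] by simp
  have K: "norm (fold (*v) w x) \<le> K * norm x" if w: "w \<in> lists F" for w x
  proof -
    have "fold (*v) w x = fold (*v) w (\<Sum>b\<in>Basis. (x \<bullet> b) *\<^sub>R b)"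
      by (simp only: euclidean_representation)
    also have "\<dots> = (\<Sum>b\<in>Basis. (x \<bullet> b) *\<^sub>R fold (*v) w b)"
      by (simp add: linear_sum[OF linear_fold_matrix_vector_mult]
          linear_scale[OF linear_fold_matrix_vector_mult])
    also have "norm \<dots> \<le> (\<Sum>b\<in>Basis. norm x * B b)"
      by (rule sum_norm_le) (auto intro!: mult_mono B w Basis_le_norm)
    finally show ?thesis
      by (simp add: K_def sum_distrib_left mult.commute)
  qed
  have K0: "0 \<le> K"
    by (simp add: K_def sum_nonneg B0)
  have "nrm (x n) \<le> (C * K / c) * nrm (x 0)" if "\<forall>n. A n \<in> F" "solution A x" for A x n
  proof -
    have "nrm (x n) \<le> C * norm (x n)"
      by (rule c)
    also have "\<dots> \<le> C * (K * norm (x 0))"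
      using c K[of "map A [0..<n]" "x 0"] that(1) solution_eq_fold[OF that(2), of n]
      by (intro mult_left_mono) (auto simp: lists_eq_set)
    also have "\<dots> = (C * K / c) * (c * norm (x 0))"
      using c by simp
    also have "\<dots> \<le> (C * K / c) * nrm (x 0)"
      using c K0 by (intro mult_left_mono) auto
    finally show ?thesis .
  qed
  then show ?thesis
    unfolding lyapunov_abs_stable_def
    by (intro exI[of _ "C * K / c"]) (auto intro!: SUP_least)
qed

lemma quasi_controllable_unbounded_orbit:
  fixes F :: "(real ^ 'n ^ 'n) set"
  assumes "is_norm nrm" "quasi_controllable F" "\<not> lyapunov_abs_stable nrm F" "x \<noteq> 0"
  shows "\<not> bounded ((\<lambda>w. fold (*v) w x) ` lists F)"
proof -
  define V where "V = {x :: real ^ 'n. bounded ((\<lambda>w. fold (*v) w x) ` lists F)}"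
  have "subspace V"
  proof (rule subspaceI)
    show "0 \<in> V"
      by (auto simp: V_def linear_0[OF linear_fold_matrix_vector_mult] bounded_iff)
  next
    fix y z assume "y \<in> V" "z \<in> V"
    then show "y + z \<in> V"
      by (auto simp: V_def linear_add[OF linear_fold_matrix_vector_mult] intro: bounded_plus_comp)
  next
    fix a :: real and y assume "y \<in> V"
    then have "bounded ((\<lambda>z. a *\<^sub>R z) ` (\<lambda>w. fold (*v) w y) ` lists F)"
      unfolding V_def by (intro bounded_scaling) simp
    then show "a *\<^sub>R y \<in> V"
      by (simp add: V_def linear_scale[OF linear_fold_matrix_vector_mult] image_image)
  qed
  moreover have "A *v y \<in> V" if "A \<in> F" "y \<in> V" for A y
  proof -
    \<comment> \<open>Reading \<open>w\<close> from \<open>A *v y\<close> is reading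
      \<open>A # w\<close> from \<open>y\<close>, so the orbit only shrinks.\<close>
    have "(\<lambda>w. fold (*v) w (A *v y)) ` lists F \<subseteq> (\<lambda>w. fold (*v) w y) ` lists F"
    proof (rule image_subsetI)
      fix w assume "w \<in> lists F"
      then show "fold (*v) w (A *v y) \<in> (\<lambda>w. fold (*v) w y) ` lists F"
        using \<open>A \<in> F\<close> by (intro image_eqI[of _ _ "A # w"]) auto
    qed
    then show ?thesis
      using that(2) bounded_subset unfolding V_def by blast
  qed
  moreover have "V \<noteq> UNIV"
    using lyapunov_abs_stable_if_bounded_orbits[OF assms(1), of F] assms(3)
    unfolding V_def by blast
  ultimately have "V = {0}"
    using assms(2) unfolding quasi_controllable_def by blast
  then show ?thesis
    using assms(4) unfolding V_def by blast
qed

section \<open>Exponential instability from doubling words\<close>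

text \<open>Doubling within at most \<open>L\<close> steps is growth by at least the
  \<open>L\<close>-th root of 2 per step on average. Boundedness of \<open>F\<close> limits how far
  a solution can dip inside a word.\<close>

lemma abs_exp_unstable_if_doubling_words:
  fixes F :: "(real ^ 'n ^ 'n) set"
  assumes "is_norm nrm" "bounded F"
    and doubling: "\<And>y. y \<noteq> 0 \<Longrightarrow>
      \<exists>w\<in>lists F. length w \<le> L \<and> 2 * norm y \<le> norm (fold (*v) w y)"
  shows "abs_exp_unstable nrm F"
proof -
  obtain c D where c: "0 < c" "0 < D" "\<And>x. c * norm x \<le> nrm x" "\<And>x. nrm x \<le> D * norm x"
    using is_norm_equiv_norm[OF assms(1)] by metis
  obtain K where K: "\<And>A x. norm ((A :: real ^ 'n ^ 'n) *v x) \<le> norm A * norm x * K" "0 < K"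
    using bounded_bilinear.pos_bounded[OF bounded_bilinear_matrix_vector_mult] by blast
  obtain R where R: "\<And>A. A \<in> F \<Longrightarrow> norm A \<le> R"
    using assms(2) unfolding bounded_iff by blast
  \<comment> \<open>The maximum with 1 makes the powers of \<open>C\<close> increasing, so that
    \<open>C ^ L\<close> dominates every shorter word.\<close>
  define C where "C = max 1 (R * K)"
  have C: "norm (A *v x) \<le> C * norm x" if "A \<in> F" for A x
  proof -
    have "norm (A *v x) \<le> norm A * K * norm x"
      using K(1)[of A x] by (simp add: mult_ac)
    also have "\<dots> \<le> C * norm x"
      using R[OF that] K(2) by (intro mult_right_mono) (auto simp: C_def le_max_iff_disj)
    finally show ?thesis .
  qed
  have C1: "1 \<le> C"
    by (simp add: C_def)
  \<comment> \<open>The empty word fixes \<open>y\<close> and cannot double it; hence every newly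
    chosen word supplies a matrix for the next step.\<close>
  have nonempty: "w \<noteq> []" if "y \<noteq> 0" "2 * norm y \<le> norm (fold (*v) w y)"
    for w and y :: "real ^ 'n"
    using that by auto
  have L: "0 < L"
  proof -
    obtain y :: "real ^ 'n" where "y \<noteq> 0"
      using vector_choose_size[of 1] by force
    then obtain w :: "(real ^ 'n ^ 'n) list" where "length w \<le> L" "w \<noteq> []"
      using doubling[of y] nonempty by blast
    then show ?thesis by (cases w) auto
  qed
  \<comment> \<open>With this rate, \<open>lam ^ length w \<le> 2\<close> for every word of length
    at most \<open>L\<close>, so one doubling pays for the whole word.\<close>
  define lam where "lam = root L 2"
  have lam: "1 < lam" "lam ^ L = 2"
    using L by (simp_all add: lam_def)
  \<comment> \<open>The factor \<open>C ^ L\<close> accounts for the dip inside a word,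
    \<open>c\<close> and \<open>D\<close> for the passage between \<open>nrm\<close> and the
    Euclidean norm.\<close>
  define \<kappa> where "\<kappa> = c / (D * C ^ L)"
  have "\<exists>A x. (\<forall>n. A n \<in> F) \<and> solution A x \<and> x 0 = v \<and> (\<forall>n. \<kappa> * lam ^ n * nrm (x 0) \<le> nrm (x n))"
    if "v \<noteq> 0" for v
  proof -
    txt \<open>A state \<open>(y, r)\<close> at time \<open>n\<close> is the current vector together with the rest of the word
      being read; the invariant bounds the vector that will be reached when \<open>r\<close> is used up.\<close>
    define I where "I n s = (case s of (y, r) \<Rightarrow> r \<in> lists F \<and> length r \<le> L \<and>
      lam ^ (n + length r) * norm v \<le> norm (fold (*v) r y) \<and> (n = 0 \<longrightarrow> y = v))"
      for n and s :: "(real ^ 'n) \<times> (real ^ 'n ^ 'n) list"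
    have "\<exists>s'. I (Suc n) s' \<and> (\<exists>A\<in>F. fst s' = A *v fst s)" if "I n s" for n s
    proof -
      obtain y r where s: "s = (y, r)"
        by (cases s)
      have Iyr: "r \<in> lists F" "length r \<le> L" "lam ^ (n + length r) * norm v \<le> norm (fold (*v) r y)"
        using that by (auto simp: I_def s)
      obtain A r' where A: "A # r' \<in> lists F" "length (A # r') \<le> L"
        "lam ^ (n + length (A # r')) * norm v \<le> norm (fold (*v) (A # r') y)"
      proof (cases r)
        case (Cons A r')
        with Iyr that show thesis by blast
      next
        \<comment> \<open>The word is used up, so a new doubling word is chosen; the invariant
          guarantees that the current vector is nonzero.\<close>
        case Nil
        with Iyr have y: "lam ^ n * norm v \<le> norm y" by simp
        moreover have "0 < lam ^ n * norm v"
          using lam \<open>v \<noteq> 0\<close> by simp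
        ultimately have "y \<noteq> 0" by auto
        then obtain w where w: "w \<in> lists F" "length w \<le> L" "2 * norm y \<le> norm (fold (*v) w y)"
          using doubling by blast
        have "lam ^ (n + length w) * norm v = lam ^ length w * (lam ^ n * norm v)"
          by (simp add: power_add)
        also have "\<dots> \<le> 2 * norm y"
          using y lam power_increasing[OF w(2), of lam] by (intro mult_mono) auto
        also note w(3)
        finally show thesis
          using w nonempty[OF \<open>y \<noteq> 0\<close> w(3)] that by (cases w) auto
      qed
      then show ?thesis
        by (intro exI[of _ "(A *v y, r')"]) (auto simp: I_def s)
    qed
    moreover have "I 0 (v, [])"
      by (simp add: I_def)
    ultimately obtain f where f: "\<And>n. I n (f n)" "\<And>n. \<exists>A\<in>F. fst (f (Suc n)) = A *v fst (f n)"
      using dependent_nat_choice[of I "\<lambda>_ s s'. \<exists>A\<in>F. fst s' = A *v fst s"] by metis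
    define x where "x n = fst (f n)" for n
    obtain A where A: "\<And>n. A n \<in> F" "\<And>n. x (Suc n) = A n *v x n"
      using f(2) unfolding x_def by metis
    \<comment> \<open>Dependent choice leaves the initial state free; the clause of \<open>I\<close>
      for \<open>n = 0\<close> pins its vector to \<open>v\<close>.\<close>
    have x0: "x 0 = v"
      using f(1)[of 0] by (auto simp: I_def x_def split: prod.splits)
    have "\<kappa> * lam ^ n * nrm v \<le> nrm (x n)" for n
    proof -
      obtain r where r: "r \<in> lists F" "length r \<le> L"
        "lam ^ (n + length r) * norm v \<le> norm (fold (*v) r (x n))"
        using f(1)[of n] by (auto simp: I_def x_def split: prod.splits)
      \<comment> \<open>The invariant speaks of the end of the current word. At most
        \<open>L\<close> matrices remain, each stretching by at most \<open>C\<close>, so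
        \<open>x n\<close> itself is smaller by at most the factor \<open>C ^ L\<close>.\<close>
      have "lam ^ n * norm v \<le> lam ^ (n + length r) * norm v"
        using lam by (intro mult_right_mono power_increasing) auto
      also note r(3)
      also have "norm (fold (*v) r (x n)) \<le> C ^ length r * norm (x n)"
        using r(1) C C1 by (intro norm_fold_matrix_vector_mult_le) auto
      also have "\<dots> \<le> C ^ L * norm (x n)"
        using r(2) C1 by (intro mult_right_mono power_increasing) auto
      finally have growth: "lam ^ n * norm v \<le> C ^ L * norm (x n)" .
      have "\<kappa> * lam ^ n * nrm v \<le> \<kappa> * lam ^ n * (D * norm v)"
        using c lam C1 by (intro mult_left_mono) (auto simp: \<kappa>_def)
      also have "\<dots> = c / C ^ L * (lam ^ n * norm v)"
        using c by (simp add: \<kappa>_def)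
      also have "\<dots> \<le> c / C ^ L * (C ^ L * norm (x n))"
        using c C1 growth by (intro mult_left_mono) auto
      also have "\<dots> = c * norm (x n)"
        using C1 by simp
      also have "\<dots> \<le> nrm (x n)"
        by (rule c)
      finally show ?thesis .
    qed
    then show ?thesis
      using A x0 by (intro exI[of _ A] exI[of _ x]) (auto simp: solution_def)
  qed
  moreover have "0 < \<kappa>"
    using c C1 by (simp add: \<kappa>_def)
  ultimately show ?thesis
    unfolding abs_exp_unstable_def abs_exp_unstable_with_def using lam(1) by blast
qed

text \<open>The growing solution from a single nonzero vector already outruns every candidate
  \<open>\<mu>\<close>.\<close>

lemma abs_exp_unstable_imp_not_lyapunov_abs_stable:
  fixes F :: "(real ^ 'n ^ 'n) set"
  assumes "is_norm nrm" "abs_exp_unstable nrm F"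
  shows "\<not> lyapunov_abs_stable nrm F"
proof
  assume "lyapunov_abs_stable nrm F"
  then obtain \<mu> where \<mu>: "\<And>A x. \<lbrakk>\<And>n. A n \<in> F; solution A x\<rbrakk> \<Longrightarrow>
      (SUP n. ereal (nrm (x n))) \<le> ereal (\<mu> * nrm (x 0))"
    unfolding lyapunov_abs_stable_def by blast
  obtain lam \<kappa> where lam: "1 < lam" "0 < \<kappa>" and unstable: "\<And>v. v \<noteq> 0 \<Longrightarrow>
      \<exists>A x. (\<forall>n. A n \<in> F) \<and> solution A x \<and> x 0 = v \<and> (\<forall>n. \<kappa> * lam ^ n * nrm (x 0) \<le> nrm (x n))"
    using assms(2) unfolding abs_exp_unstable_def abs_exp_unstable_with_def by metis
  obtain v :: "real ^ 'n" where v: "v \<noteq> 0"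
    using vector_choose_size[of 1] by force
  then obtain A x where x: "\<And>n. A n \<in> F" "solution A x" "x 0 = v"
    "\<And>n. \<kappa> * lam ^ n * nrm v \<le> nrm (x n)"
    using unstable[OF v] by auto
  have "0 < nrm v"
    using v assms(1) unfolding is_norm_def by (metis order_le_less)
  have "\<kappa> * lam ^ n \<le> \<mu>" for n
  proof -
    have "ereal (nrm (x n)) \<le> ereal (\<mu> * nrm (x 0))"
      using \<mu>[of A x] x(1,2) by (meson SUP_upper UNIV_I order_trans)
    then have "\<kappa> * lam ^ n * nrm v \<le> \<mu> * nrm v"
      using x(3) x(4)[of n] by simp
    then show ?thesis
      using \<open>0 < nrm v\<close> by simp
  qed
  moreover obtain n where "\<mu> / \<kappa> < lam ^ n"
    using real_arch_pow[OF lam(1)] by blast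
  ultimately show False
    using lam(2) by (metis mult.commute not_less pos_divide_less_eq)
qed

section \<open>Uniform doubling for small parameters\<close>

text \<open>Strict expansion is an open condition on parameter and vector jointly, and the unit
  sphere is compact. Words are taken over indices so that one word can be used for all values of the
  parameter.\<close>

lemma eventually_doubling_words:
  fixes A :: "'i \<Rightarrow> real \<Rightarrow> real ^ 'n ^ 'n"
  assumes cont: "\<And>i. i \<in> J \<Longrightarrow> isCont (A i) 0"
    and expand: "\<And>x. x \<noteq> 0 \<Longrightarrow>
      \<exists>w\<in>lists J. 2 * norm x < norm (fold (*v) (map (\<lambda>i. A i 0) w) x)"
  obtains \<delta> L where "0 < \<delta>" "\<And>\<tau> y. \<lbrakk>\<bar>\<tau>\<bar> < \<delta>; y \<noteq> 0\<rbrakk> \<Longrightarrow>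
      \<exists>w\<in>lists J. length w \<le> L \<and> 2 * norm y \<le> norm (fold (*v) (map (\<lambda>i. A i \<tau>) w) y)"
proof -
  define S where "S = sphere (0 :: real ^ 'n) 1"
  have "\<exists>w T U. w \<in> lists J \<and> open T \<and> 0 \<in> T \<and> open U \<and> x \<in> U \<and>
      (\<forall>\<tau>\<in>T. \<forall>y\<in>U. 2 < norm (fold (*v) (map (\<lambda>i. A i \<tau>) w) y))" if "x \<in> S" for x
  proof -
    have "norm x = 1" "x \<noteq> 0"
      using that by (auto simp: S_def)
    then obtain w where w: "w \<in> lists J" "2 < norm (fold (*v) (map (\<lambda>i. A i 0) w) x)"
      using expand[of x] by auto
    have "((\<lambda>p. norm (fold (*v) (map (\<lambda>i. A i (fst p)) w) (snd p))) \<longlongrightarrow>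
        norm (fold (*v) (map (\<lambda>i. A i 0) w) x)) (nhds (0, x))"
    proof (intro tendsto_norm tendsto_fold_matrix_vector_mult)
      have id: "((\<lambda>p. p) \<longlongrightarrow> (0, x)) (nhds (0, x))"
        by (simp add: filterlim_def)
      show "(snd \<longlongrightarrow> x) (nhds (0, x))"
        using tendsto_snd[OF id] by simp
      fix i assume "i \<in> set w"
      then have "isCont (A i) 0"
        using cont w(1) by auto
      then show "((\<lambda>p. A i (fst p)) \<longlongrightarrow> A i 0) (nhds (0, x))"
        using tendsto_fst[OF id] by (intro isCont_tendsto_compose[of 0 "A i"]) simp_all
    qed
    \<comment> \<open>The strict inequality persists near \<open>(0, x)\<close>; a product
      neighbourhood inside then lets parameter and vector vary independently.\<close>
    then have "eventually (\<lambda>p. 2 < norm (fold (*v) (map (\<lambda>i. A i (fst p)) w) (snd p))) (nhds (0, x))"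
      using w(2) by (rule order_tendstoD(1))
    then obtain W where W: "open W" "(0, x) \<in> W"
      "\<And>p. p \<in> W \<Longrightarrow> 2 < norm (fold (*v) (map (\<lambda>i. A i (fst p)) w) (snd p))"
      unfolding eventually_nhds by blast
    obtain T U where "open T" "open U" "(0, x) \<in> T \<times> U" "T \<times> U \<subseteq> W"
      using open_prod_elim[OF W(1,2)] by blast
    with w(1) W(3) show ?thesis
      by (intro exI[of _ w] exI[of _ T] exI[of _ U]) fastforce
  qed
  then obtain w T U where wTU: "\<And>x. x \<in> S \<Longrightarrow> w x \<in> lists J \<and> open (T x) \<and> 0 \<in> T x \<and> open (U x)
      \<and> x \<in> U x \<and> (\<forall>\<tau>\<in>T x. \<forall>y\<in>U x. 2 < norm (fold (*v) (map (\<lambda>i. A i \<tau>) (w x)) y))"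
    by metis
  obtain X where X: "X \<subseteq> S" "finite X" "S \<subseteq> (\<Union>x\<in>X. U x)"
    proof (rule compactE_image[of S S U])
    show "compact S"
      by (simp add: S_def)
  qed (use wTU in blast)+
  have "open (\<Inter>x\<in>X. T x)" "0 \<in> (\<Inter>x\<in>X. T x)"
    using X wTU by (auto intro!: open_INT)
  then obtain \<delta> where \<delta>: "0 < \<delta>" "ball 0 \<delta> \<subseteq> (\<Inter>x\<in>X. T x)"
    by (meson open_contains_ball)
  \<comment> \<open>The sum over the finite subcover is a convenient common bound for the lengths of
    its words.\<close>
  define L where "L = (\<Sum>x\<in>X. length (w x))"
  show thesis
  proof
    show "0 < \<delta>" by fact
    fix \<tau> :: real and y :: "real ^ 'n" assume "\<bar>\<tau>\<bar> < \<delta>" "y \<noteq> 0"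
    then have "y /\<^sub>R norm y \<in> S"
      by (simp add: S_def)
    then obtain x where x: "x \<in> X" "y /\<^sub>R norm y \<in> U x"
      using X by blast
    have "\<tau> \<in> T x"
      using \<delta>(2) \<open>\<bar>\<tau>\<bar> < \<delta>\<close> x(1) by (auto simp: subset_iff)
    then have "2 < norm (fold (*v) (map (\<lambda>i. A i \<tau>) (w x)) (y /\<^sub>R norm y))"
      using wTU x X(1) by blast
    \<comment> \<open>Homogeneity carries the estimate from the unit sphere to
      \<open>y\<close>.\<close>
    then have "2 * norm y \<le> norm (fold (*v) (map (\<lambda>i. A i \<tau>) (w x)) y)"
      using \<open>y \<noteq> 0\<close> by (simp add: linear_scale[OF linear_fold_matrix_vector_mult] field_simps)
    moreover have "length (w x) \<le> L"
      unfolding L_def using X(2) x(1) by (intro member_le_sum) auto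
    ultimately show "\<exists>w\<in>lists J. length w \<le> L \<and>
        2 * norm y \<le> norm (fold (*v) (map (\<lambda>i. A i \<tau>) w) y)"
      using wTU x(1) X(1) by blast
  qed
qed

theorem theorem8:
  fixes nrm :: "real ^ 'n \<Rightarrow> real"
    and M :: nat
    and A :: "nat \<Rightarrow> real \<Rightarrow> real ^ 'n ^ 'n"
  assumes "is_norm nrm"
    and "quasi_controllable ((\<lambda>i. A i 0) ` {1..M})"
    and "\<And>i. i \<in> {1..M} \<Longrightarrow> isCont (A i) 0"
    and "\<not> lyapunov_abs_stable nrm ((\<lambda>i. A i 0) ` {1..M})"
  shows "\<exists>\<delta>>0. \<forall>\<tau>::real. \<bar>\<tau>\<bar> < \<delta> \<longrightarrow>
           \<not> lyapunov_abs_stable nrm ((\<lambda>i. A i \<tau>) ` {1..M}) \<and>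
           abs_exp_unstable nrm ((\<lambda>i. A i \<tau>) ` {1..M})"
proof -
  have "\<exists>w\<in>lists {1..M}. 2 * norm x < norm (fold (*v) (map (\<lambda>i. A i 0) w) x)" if "x \<noteq> 0" for x
  proof (rule ccontr)
    assume "\<not> ?thesis"
    \<comment> \<open>If no word more than doubles \<open>x\<close>, its whole orbit stays within
      \<open>2 * norm x\<close>.\<close>
    then have "bounded ((\<lambda>w. fold (*v) w x) ` lists ((\<lambda>i. A i 0) ` {1..M}))"
      unfolding bounded_iff lists_image by (intro exI[of _ "2 * norm x"]) (auto simp: not_less)
    then show False
      using quasi_controllable_unbounded_orbit[OF assms(1,2,4) that] by blast
  qed
  then obtain \<delta> L where \<delta>: "0 < \<delta>" and doubling: "\<And>\<tau> y. \<lbrakk>\<bar>\<tau>\<bar> < \<delta>; y \<noteq> 0\<rbrakk> \<Longrightarrow>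
      \<exists>w\<in>lists {1..M}. length w \<le> L \<and> 2 * norm y \<le> norm (fold (*v) (map (\<lambda>i. A i \<tau>) w) y)"
    using eventually_doubling_words[of "{1..M}" A, OF assms(3)] by metis
  have "abs_exp_unstable nrm ((\<lambda>i. A i \<tau>) ` {1..M})" if "\<bar>\<tau>\<bar> < \<delta>" for \<tau>
  proof (rule abs_exp_unstable_if_doubling_words[where L = L])
    show "bounded ((\<lambda>i. A i \<tau>) ` {1..M})"
      by (simp add: finite_imp_bounded)
    show "\<exists>w\<in>lists ((\<lambda>i. A i \<tau>) ` {1..M}). length w \<le> L \<and> 2 * norm y \<le> norm (fold (*v) w y)"
      if "y \<noteq> 0" for y
      using doubling[OF \<open>\<bar>\<tau>\<bar> < \<delta>\<close> that] unfolding lists_image by auto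
  qed fact
  then show ?thesis
    using \<delta> abs_exp_unstable_imp_not_lyapunov_abs_stable[OF assms(1)] by blast
qed

end
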